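(* Fix a constant $c$. Let $m$ be a computable function such that for every $n$, $\mathsf{PA}$ proves that there are at least $m(n)$ strings $x$ of length $n$ with $\mathrm{C}(x)\ge n-c$. Let $\phi$ be a formula not provable in $\mathsf{PA}$. Then one can choose, for each $n$, a set $S_n$ of $m(n)$ strings of length $n$ such that $\mathsf{PA}$ together with the axioms "$\mathrm{C}(x)\ge n-c$" for all $n$ and all $x\in S_n$ does not prove $\phi$.
   Context: $\mathsf{PA}$ is Peano arithmetic. $\mathrm{C}$ is plain Kolmogorov complexity, represented in $\mathsf{PA}$ as $\mathrm{C}_D(x)=\min\{|p|:D(p)=x\}$ for a provably optimal interpreter $D$ (for every partial computable $D'$ there is $c'$ with $\mathsf{PA}\vdash\forall x\,[\mathrm{C}_D(x)\le\mathrm{C}_{D'}(x)+c']$). Examples of such $m$ given in the paper: $m(n)=2^n-2^{n-c}$. *)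

theory Defs
  imports Main
begin

section \<open>First-order arithmetic\<close>

text \<open>Terms and formulas over the language \<open>0, S, +, \<cdot>, =\<close>, with de Bruijn indices:
  \<open>Var 0\<close> is bound by the innermost enclosing quantifier.\<close>

datatype tm = Var nat | Zero | Succ tm | Plus tm tm | Times tm tm

datatype fm = Eq tm tm | Fls | Imp fm fm | Forall fm

abbreviation Neg :: "fm \<Rightarrow> fm" where "Neg p \<equiv> Imp p Fls"
abbreviation And :: "fm \<Rightarrow> fm \<Rightarrow> fm" where "And p q \<equiv> Neg (Imp p (Neg q))"
abbreviation Or :: "fm \<Rightarrow> fm \<Rightarrow> fm" where "Or p q \<equiv> Imp (Neg p) q"
abbreviation Exists :: "fm \<Rightarrow> fm" where "Exists p \<equiv> Neg (Forall (Neg p))"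

definition Conj :: "fm list \<Rightarrow> fm" where
  "Conj ps = foldr And ps (Neg Fls)"

primrec tsubst :: "(nat \<Rightarrow> tm) \<Rightarrow> tm \<Rightarrow> tm" where
  "tsubst s (Var n) = s n"
| "tsubst s Zero = Zero"
| "tsubst s (Succ t) = Succ (tsubst s t)"
| "tsubst s (Plus t u) = Plus (tsubst s t) (tsubst s u)"
| "tsubst s (Times t u) = Times (tsubst s t) (tsubst s u)"

definition lift :: "tm \<Rightarrow> tm" where
  "lift = tsubst (\<lambda>n. Var (Suc n))"

text \<open>Simultaneous capture-avoiding substitution.\<close>

primrec fsubst :: "(nat \<Rightarrow> tm) \<Rightarrow> fm \<Rightarrow> fm" where
  "fsubst s (Eq t u) = Eq (tsubst s t) (tsubst s u)"
| "fsubst s Fls = Fls"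
| "fsubst s (Imp p q) = Imp (fsubst s p) (fsubst s q)"
| "fsubst s (Forall p) = Forall (fsubst (case_nat (Var 0) (\<lambda>n. lift (s n))) p)"

definition flift :: "fm \<Rightarrow> fm" where
  "flift = fsubst (\<lambda>n. Var (Suc n))"

definition inst :: "fm \<Rightarrow> tm \<Rightarrow> fm" where
  "inst p t = fsubst (case_nat t Var) p"

primrec tfv :: "tm \<Rightarrow> nat set" where
  "tfv (Var n) = {n}"
| "tfv Zero = {}"
| "tfv (Succ t) = tfv t"
| "tfv (Plus t u) = tfv t \<union> tfv u"
| "tfv (Times t u) = tfv t \<union> tfv u"

primrec fv :: "fm \<Rightarrow> nat set" where
  "fv (Eq t u) = tfv t \<union> tfv u"
| "fv Fls = {}"
| "fv (Imp p q) = fv p \<union> fv q"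
| "fv (Forall p) = {n. Suc n \<in> fv p}"

text \<open>Truth in the standard model.\<close>

primrec tval :: "(nat \<Rightarrow> nat) \<Rightarrow> tm \<Rightarrow> nat" where
  "tval e (Var n) = e n"
| "tval e Zero = 0"
| "tval e (Succ t) = Suc (tval e t)"
| "tval e (Plus t u) = tval e t + tval e u"
| "tval e (Times t u) = tval e t * tval e u"

primrec sat :: "(nat \<Rightarrow> nat) \<Rightarrow> fm \<Rightarrow> bool" where
  "sat e (Eq t u) \<longleftrightarrow> tval e t = tval e u"
| "sat e Fls \<longleftrightarrow> False"
| "sat e (Imp p q) \<longleftrightarrow> (sat e p \<longrightarrow> sat e q)"
| "sat e (Forall p) \<longleftrightarrow> (\<forall>n. sat (case_nat n e) p)"

text \<open>Classical natural deduction with equality.  The set of hypotheses may be infinite;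
  in \<open>AllI\<close>, lifting the hypotheses makes \<open>Var 0\<close> fresh for them.\<close>

inductive proves :: "fm set \<Rightarrow> fm \<Rightarrow> bool" (infix "\<turnstile>" 50) where
  Assm: "p \<in> H \<Longrightarrow> H \<turnstile> p"
| ImpI: "insert p H \<turnstile> q \<Longrightarrow> H \<turnstile> Imp p q"
| ImpE: "H \<turnstile> Imp p q \<Longrightarrow> H \<turnstile> p \<Longrightarrow> H \<turnstile> q"
| Classical: "insert (Neg p) H \<turnstile> Fls \<Longrightarrow> H \<turnstile> p"
| AllI: "flift ` H \<turnstile> p \<Longrightarrow> H \<turnstile> Forall p"
| AllE: "H \<turnstile> Forall p \<Longrightarrow> H \<turnstile> inst p t"
| Refl: "H \<turnstile> Eq t t"
| Subst: "H \<turnstile> Eq t u \<Longrightarrow> H \<turnstile> inst p t \<Longrightarrow> H \<turnstile> inst p u"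


section \<open>Peano arithmetic\<close>

definition Induct :: "fm \<Rightarrow> fm" where
  "Induct p = Imp (inst p Zero)
     (Imp (Forall (Imp p (fsubst (Var(0 := Succ (Var 0))) p))) (Forall p))"

text \<open>The induction axioms are the universal closures of the instances of the schema.\<close>

definition PA :: "fm set" where
  "PA =
    {Forall (Neg (Eq (Succ (Var 0)) Zero)),
     Forall (Forall (Imp (Eq (Succ (Var 1)) (Succ (Var 0))) (Eq (Var 1) (Var 0)))),
     Forall (Eq (Plus (Var 0) Zero) (Var 0)),
     Forall (Forall (Eq (Plus (Var 1) (Succ (Var 0))) (Succ (Plus (Var 1) (Var 0))))),
     Forall (Eq (Times (Var 0) Zero) Zero),
     Forall (Forall (Eq (Times (Var 1) (Succ (Var 0))) (Plus (Times (Var 1) (Var 0)) (Var 1))))}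
    \<union> {(Forall ^^ k) (Induct p) | k p. fv ((Forall ^^ k) (Induct p)) = {}}"

primrec num :: "nat \<Rightarrow> tm" where
  "num 0 = Zero"
| "num (Suc n) = Succ (num n)"

definition Leq :: "tm \<Rightarrow> tm \<Rightarrow> fm" where
  "Leq t u = Exists (Eq (Plus (lift t) (Var 0)) (lift u))"

definition Less :: "tm \<Rightarrow> tm \<Rightarrow> fm" where
  "Less t u = Leq (Succ t) u"

inductive delta0 :: "fm \<Rightarrow> bool" where
  "delta0 (Eq t u)"
| "delta0 Fls"
| "delta0 p \<Longrightarrow> delta0 q \<Longrightarrow> delta0 (Imp p q)"
| "delta0 p \<Longrightarrow> delta0 (Forall (Imp (Leq (Var 0) (lift t)) p))"

inductive sigma1 :: "fm \<Rightarrow> bool" where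
  "delta0 p \<Longrightarrow> sigma1 p"
| "sigma1 p \<Longrightarrow> sigma1 (Exists p)"

text \<open>``There are at least \<open>k\<close> objects \<open>x\<close> with \<open>P x\<close>'', i.e.
  \<open>\<exists>x\<^sub>0 \<dots> x\<^sub>k\<^sub>-\<^sub>1\<close>, pairwise distinct, all satisfying \<open>P\<close>.\<close>

definition AtLeast :: "nat \<Rightarrow> (tm \<Rightarrow> fm) \<Rightarrow> fm" where
  "AtLeast k P = (Exists ^^ k)
     (And (Conj [Neg (Eq (Var i) (Var j)). j \<leftarrow> [0..<k], i \<leftarrow> [0..<j]])
          (Conj [P (Var i). i \<leftarrow> [0..<k]]))"


section \<open>Computable functions\<close>

text \<open>Kleene's \<open>\<mu>\<close>-recursive functions; \<open>reval f xs y\<close> means that \<open>f\<close> halts on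
  the arguments \<open>xs\<close> with value \<open>y\<close>.\<close>

datatype recf = RZero | RSucc | RProj nat | RComp recf "recf list" | RPrim recf recf | RMin recf

inductive reval :: "recf \<Rightarrow> nat list \<Rightarrow> nat \<Rightarrow> bool" where
  "reval RZero xs 0"
| "reval RSucc [x] (Suc x)"
| "i < length xs \<Longrightarrow> reval (RProj i) xs (xs ! i)"
| "list_all2 (\<lambda>g y. reval g xs y) gs ys \<Longrightarrow> reval f ys z \<Longrightarrow> reval (RComp f gs) xs z"
| "reval f xs y \<Longrightarrow> reval (RPrim f g) (0 # xs) y"
| "reval (RPrim f g) (n # xs) y \<Longrightarrow> reval g (n # y # xs) z \<Longrightarrow> reval (RPrim f g) (Suc n # xs) z"
| "reval f (n # xs) 0 \<Longrightarrow> \<forall>i<n. \<exists>y. reval f (i # xs) (Suc y) \<Longrightarrow> reval (RMin f) xs n"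

definition computable :: "(nat \<Rightarrow> nat) \<Rightarrow> bool" where
  "computable g \<longleftrightarrow> (\<exists>f. \<forall>n y. reval f [n] y \<longleftrightarrow> y = g n)"

text \<open>Binary strings are identified with natural numbers by bijective base-2 numeration.\<close>

primrec code :: "bool list \<Rightarrow> nat" where
  "code [] = 0"
| "code (b # w) = 2 * code w + (if b then 2 else 1)"

definition partial_computable :: "(bool list \<Rightarrow> bool list option) \<Rightarrow> bool" where
  "partial_computable D \<longleftrightarrow>
     (\<exists>f. \<forall>p y. reval f [code p] y \<longleftrightarrow> (\<exists>x. D p = Some x \<and> y = code x))"


section \<open>Kolmogorov complexity in Peano arithmetic\<close>

text \<open>Goedel's beta function: \<open>y\<close> is the remainder of \<open>a\<close> modulo \<open>1 + b (i + 1)\<close>.\<close>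

definition Beta :: "tm \<Rightarrow> tm \<Rightarrow> tm \<Rightarrow> tm \<Rightarrow> fm" where
  "Beta a b i y =
     (let d = Succ (Times b (Succ i))
      in And (Exists (Eq (Plus (Times (Var 0) (lift d)) (lift y)) (lift a))) (Less y d))"

text \<open>``The string with code \<open>x\<close> has length \<open>l\<close>'': some sequence \<open>s\<^sub>0, \<dots>, s\<^sub>l\<close>, coded by
  \<open>a = Var 1\<close> and \<open>b = Var 0\<close>, has \<open>s\<^sub>0 = 0\<close>, \<open>s\<^sub>l = x\<close> and
  \<open>s\<^sub>i\<^sub>+\<^sub>1 \<in> {2 s\<^sub>i + 1, 2 s\<^sub>i + 2}\<close> for all \<open>i < l\<close> (adding one bit to the string).\<close>

definition Len :: "tm \<Rightarrow> tm \<Rightarrow> fm" where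
  "Len x l = Exists (Exists
     (And (Beta (Var 1) (Var 0) Zero Zero)
     (And (Beta (Var 1) (Var 0) (lift (lift l)) (lift (lift x)))
          (Forall (Imp (Less (Var 0) (lift (lift (lift l))))
            (Exists (Exists (And (Beta (Var 4) (Var 3) (Var 2) (Var 1))
                    (And (Beta (Var 4) (Var 3) (Succ (Var 2)) (Var 0))
                         (Or (Eq (Var 0) (Succ (Plus (Var 1) (Var 1))))
                             (Eq (Var 0) (Succ (Succ (Plus (Var 1) (Var 1)))))))))))))))"

text \<open>A formula \<open>d\<close> standing for \<open>D(p) = x\<close> has free variables \<open>p = Var 0\<close> and \<open>x = Var 1\<close>;
  \<open>app2 d t u\<close> is \<open>D(t) = u\<close>.\<close>

definition app2 :: "fm \<Rightarrow> tm \<Rightarrow> tm \<Rightarrow> fm" where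
  "app2 d t u = fsubst (\<lambda>i. if i = 0 then t else u) d"

text \<open>\<open>d\<close> represents \<open>D\<close> in arithmetic the way an algorithm computing \<open>D\<close> does: by a
  \<open>\<Sigma>\<^sub>1\<close> formula that defines the graph of \<open>D\<close> and whose functionality \<open>PA\<close> proves.
  The last condition is essential.  A formula that is functional in the standard model only
  could, in a nonstandard model, assign every string a program of length 0, and then nothing
  would be provably optimal.\<close>

definition represents :: "fm \<Rightarrow> (bool list \<Rightarrow> bool list option) \<Rightarrow> bool" where
  "represents d D \<longleftrightarrow>
     sigma1 d \<and> fv d \<subseteq> {0, 1} \<and>
     (\<forall>p y e. sat e (app2 d (num (code p)) (num y)) \<longleftrightarrow> (\<exists>x. D p = Some x \<and> y = code x)) \<and>
     PA \<turnstile> Forall (Forall (Forall (Imp (app2 d (Var 2) (Var 1))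
                        (Imp (app2 d (Var 2) (Var 0)) (Eq (Var 1) (Var 0))))))"

definition HasProg :: "fm \<Rightarrow> tm \<Rightarrow> tm \<Rightarrow> fm" where
  "HasProg d x k = Exists (And (app2 d (Var 0) (lift x)) (Len (Var 0) (lift k)))"

text \<open>\<open>C\<^sub>D(x) = k\<close>, that is, \<open>k\<close> is the minimum of \<open>|p|\<close> over all \<open>p\<close> with \<open>D(p) = x\<close>.\<close>

definition CEq :: "fm \<Rightarrow> tm \<Rightarrow> tm \<Rightarrow> fm" where
  "CEq d x k = And (HasProg d x k) (Forall (Imp (HasProg d (lift x) (Var 0)) (Leq (lift k) (Var 0))))"

text \<open>\<open>C\<^sub>D(x) \<ge> t\<close> (true if \<open>x\<close> has no program, the minimum of the empty set being infinite).\<close>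

definition CGeq :: "fm \<Rightarrow> tm \<Rightarrow> tm \<Rightarrow> fm" where
  "CGeq d x t = Forall (Imp (CEq d (lift x) (Var 0)) (Leq (lift t) (Var 0)))"

text \<open>\<open>\<forall>x. C\<^sub>D(x) \<le> C\<^sub>D\<^sub>'(x) + c\<close>, again with infinite value where there is no program.\<close>

definition CBound :: "fm \<Rightarrow> fm \<Rightarrow> nat \<Rightarrow> fm" where
  "CBound d d' c = Forall (Forall (Imp (CEq d' (Var 1) (Var 0))
     (Exists (And (CEq d (Var 2) (Var 0)) (Leq (Var 0) (Plus (Var 1) (num c)))))))"

definition provably_optimal :: "fm \<Rightarrow> (bool list \<Rightarrow> bool list option) \<Rightarrow> bool" where
  "provably_optimal d D \<longleftrightarrow>
     partial_computable D \<and> represents d D \<and>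
     (\<forall>D' d'. partial_computable D' \<and> represents d' D' \<longrightarrow> (\<exists>c. PA \<turnstile> CBound d d' c))"

text \<open>\<open>C\<^sub>D(x) \<ge> n - c\<close>.  Truncating \<open>n - c\<close> at 0 is harmless, as complexities are natural
  numbers.\<close>

definition CRandom :: "fm \<Rightarrow> int \<Rightarrow> nat \<Rightarrow> tm \<Rightarrow> fm" where
  "CRandom d c n x = CGeq d x (num (nat (int n - c)))"

end

theory Submission
  imports Defs "HOL-Library.Countable_Set"
begin

text \<open>By completeness, a formula \<open>\<phi>\<close> that \<open>PA\<close> does not prove fails in some model of \<open>PA\<close>.
  In this model at least \<open>m n\<close> elements have length \<open>n\<close> and complexity at least \<open>n - c\<close>.
  Since \<open>n\<close> is standard, any element of length \<open>n\<close> is the value of the numeral of an actual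
  string of length \<open>n\<close>: unique division with remainder in the model makes the sequence coded
  by the beta function single-valued, and its first \<open>n + 1\<close> terms are standard.  Let \<open>S n\<close>
  consist of \<open>m n\<close> of these strings; the model satisfies all the added axioms, so
  by soundness they do not prove \<open>\<phi>\<close>.\<close>

section \<open>Substitution\<close>

abbreviation up :: "(nat \<Rightarrow> tm) \<Rightarrow> nat \<Rightarrow> tm" where
  "up s \<equiv> case_nat (Var 0) (\<lambda>n. lift (s n))"

lemma tsubst_cong: "(\<And>n. n \<in> tfv t \<Longrightarrow> s n = s' n) \<Longrightarrow> tsubst s t = tsubst s' t"
  by (induction t) auto

lemma fsubst_cong: "(\<And>n. n \<in> fv p \<Longrightarrow> s n = s' n) \<Longrightarrow> fsubst s p = fsubst s' p"
proof (induction p arbitrary: s s')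
  case (Eq t u)
  then show ?case using tsubst_cong[of t s s'] tsubst_cong[of u s s'] by simp
next
  case (Imp p q)
  then show ?case by (metis UnCI fsubst.simps(3) fv.simps(3))
next
  case (Forall p)
  have "fsubst (up s) p = fsubst (up s') p"
    by (rule Forall.IH) (auto split: nat.split simp: Forall.prems)
  then show ?case by simp
qed simp

lemma tsubst_Var [simp]: "tsubst Var t = t"
  by (induction t) auto

lemma up_Var [simp]: "up Var = Var"
  by (auto simp: fun_eq_iff lift_def split: nat.split)

lemma fsubst_Var [simp]: "fsubst Var p = p"
  by (induction p) auto

lemma tsubst_tsubst: "tsubst s (tsubst r t) = tsubst (\<lambda>n. tsubst s (r n)) t"
  by (induction t) auto

lemma tsubst_up_lift [simp]: "tsubst (up s) (lift t) = lift (tsubst s t)"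
  by (simp add: lift_def tsubst_tsubst)

lemma tsubst_case_nat_Var_lift [simp]: "tsubst (case_nat u Var) (lift t) = t"
  by (simp add: lift_def tsubst_tsubst)

lemma fsubst_fsubst: "fsubst s (fsubst r p) = fsubst (\<lambda>n. tsubst s (r n)) p"
proof (induction p arbitrary: s r)
  case (Forall p)
  have "(\<lambda>n. tsubst (up s) (up r n)) = up (\<lambda>n. tsubst s (r n))"
    by (auto simp: fun_eq_iff split: nat.split)
  then show ?case by (simp add: Forall.IH)
qed (auto simp: tsubst_tsubst)

text \<open>Fuses substitution under a binder and instantiation of that binder into one
  substitution, the form that the quantifier case of the truth lemma in \<open>completeness\<close>
  needs.\<close>

lemma inst_fsubst_up: "inst (fsubst (up s) p) t = fsubst (case_nat t s) p"
proof -
  have "(\<lambda>n. tsubst (case_nat t Var) (up s n)) = case_nat t s"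
    by (auto simp: fun_eq_iff split: nat.split)
  then show ?thesis by (simp add: inst_def fsubst_fsubst)
qed

lemma fsubst_inst: "fsubst s (inst p t) = inst (fsubst (up s) p) (tsubst s t)"
proof -
  have "(\<lambda>n. tsubst s (case_nat t Var n)) = case_nat (tsubst s t) s"
    by (auto simp: fun_eq_iff split: nat.split)
  then have "fsubst s (inst p t) = fsubst (case_nat (tsubst s t) s) p"
    by (simp add: inst_def fsubst_fsubst)
  then show ?thesis by (simp only: inst_fsubst_up)
qed

lemma fsubst_up_flift: "fsubst (up s) (flift p) = flift (fsubst s p)"
  by (simp add: flift_def fsubst_fsubst lift_def)

lemma finite_tfv: "finite (tfv t)"
  by (induction t) auto

lemma finite_fv: "finite (fv p)"
proof (induction p)
  case (Forall p)
  have "{n. Suc n \<in> fv p} = Suc -` fv p" by auto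
  then show ?case using Forall by (simp add: finite_vimageI)
qed (auto simp: finite_tfv)

lemma tsubst_num [simp]: "tsubst s (num n) = num n"
  by (induction n) auto

lemma lift_num [simp]: "lift (num n) = num n"
  by (simp add: lift_def)


section \<open>Derivations\<close>

lemma weakening: "H \<turnstile> p \<Longrightarrow> H \<subseteq> G \<Longrightarrow> G \<turnstile> p"
proof (induction arbitrary: G rule: proves.induct)
  case (ImpI p H q)
  then show ?case by (meson insert_mono proves.ImpI)
next
  case (Classical p H)
  then show ?case by (meson insert_mono proves.Classical)
next
  case (AllI H p)
  then show ?case by (meson image_mono proves.AllI)
qed (blast intro: proves.intros)+

text \<open>Every rule survives substitution; for \<open>AllI\<close> the induction hypothesis is
  used at \<open>up s\<close>, which commutes with \<open>flift\<close> on the hypotheses. The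
  purpose is the renaming of a free variable in \<open>generalize_fresh\<close>.\<close>

lemma proves_fsubst: "H \<turnstile> p \<Longrightarrow> fsubst s ` H \<turnstile> fsubst s p"
proof (induction arbitrary: s rule: proves.induct)
  case (ImpI p H q)
  then show ?case by (simp add: proves.ImpI)
next
  case (ImpE H p q)
  then show ?case by (metis fsubst.simps(3) proves.ImpE)
next
  case (Classical p H)
  have "insert (Neg (fsubst s p)) (fsubst s ` H) \<turnstile> Fls"
    using Classical.IH[of s] by simp
  then show ?case by (rule proves.Classical)
next
  case (AllI H p)
  have "fsubst (up s) ` flift ` H = flift ` fsubst s ` H"
    by (simp add: image_image fsubst_up_flift)
  then show ?case using AllI.IH[of "up s"] by (simp add: proves.AllI)
next
  case (AllE H p t)
  then show ?case by (metis fsubst.simps(4) fsubst_inst proves.AllE)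
next
  case (Subst H t u p)
  then show ?case by (metis fsubst.simps(1) fsubst_inst proves.Subst)
qed (auto intro: proves.Assm proves.Refl)

text \<open>A discharged formula is removed from the finite set again, and for \<open>AllI\<close> a
  finite subset of an image is the image of a finite subset. This carries consistency over to the
  limit of a chain.\<close>

lemma finite_derivation: "H \<turnstile> p \<Longrightarrow> \<exists>F. finite F \<and> F \<subseteq> H \<and> F \<turnstile> p"
proof (induction rule: proves.induct)
  case (Assm p H)
  then show ?case by (intro exI[of _ "{p}"]) (auto intro: proves.Assm)
next
  case (ImpI p H q)
  then obtain F where "finite F" "F \<subseteq> insert p H" "F \<turnstile> q" by blast
  moreover from this have "insert p (F - {p}) \<turnstile> q" by (auto intro: weakening)
  ultimately show ?case by (intro exI[of _ "F - {p}"]) (auto intro: proves.ImpI)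
next
  case (ImpE H p q)
  then obtain F G where "finite F" "F \<subseteq> H" "F \<turnstile> Imp p q" "finite G" "G \<subseteq> H" "G \<turnstile> p" by blast
  then show ?case
    by (intro exI[of _ "F \<union> G"]) (blast intro: proves.ImpE weakening)
next
  case (Classical p H)
  then obtain F where "finite F" "F \<subseteq> insert (Neg p) H" "F \<turnstile> Fls" by blast
  moreover from this have "insert (Neg p) (F - {Neg p}) \<turnstile> Fls" by (auto intro: weakening)
  ultimately show ?case
    by (intro exI[of _ "F - {Neg p}"]) (auto intro: proves.Classical)
next
  case (AllI H p)
  then obtain F where "finite F" "F \<subseteq> flift ` H" "F \<turnstile> p" by blast
  moreover from this obtain G where "finite G" "G \<subseteq> H" "F = flift ` G"
    by (metis finite_subset_image)
  ultimately show ?case by (auto intro: proves.AllI)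
next
  case (AllE H p t)
  then show ?case by (blast intro: proves.AllE)
next
  case (Refl H t)
  then show ?case by (blast intro: proves.Refl)
next
  case (Subst H t u p)
  then obtain F G where "finite F" "F \<subseteq> H" "F \<turnstile> Eq t u" "finite G" "G \<subseteq> H" "G \<turnstile> inst p t" by blast
  then show ?case
    by (intro exI[of _ "F \<union> G"]) (blast intro: proves.Subst weakening)
qed

section \<open>Derived rules for falsity, equality and generalization\<close>

lemma cut: "insert p H \<turnstile> q \<Longrightarrow> H \<turnstile> p \<Longrightarrow> H \<turnstile> q"
  by (blast intro: ImpI ImpE)

lemma ex_falso: "H \<turnstile> Fls \<Longrightarrow> H \<turnstile> p"
  by (blast intro: Classical weakening)

text \<open>\<open>Subst\<close> with \<open>inst\<close> unfolded, so that simplification evaluates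
  a template \<open>p\<close>: \<open>Var 0\<close> marks the place of replacement, and terms to be
  kept are lifted.\<close>

lemma Eq_replace:
  assumes "H \<turnstile> Eq t u" and "H \<turnstile> fsubst (case_nat t Var) p"
  shows "H \<turnstile> fsubst (case_nat u Var) p"
  using Subst[of H t u p] assms by (simp add: inst_def)

lemma Eq_sym: "H \<turnstile> Eq t u \<Longrightarrow> H \<turnstile> Eq u t"
  using Eq_replace[of H t u "Eq (Var 0) (lift t)"] by (simp add: Refl)

lemma Eq_trans: "H \<turnstile> Eq t u \<Longrightarrow> H \<turnstile> Eq u v \<Longrightarrow> H \<turnstile> Eq t v"
  using Eq_replace[of H u v "Eq (lift t) (Var 0)"] by simp

lemma Eq_Succ: "H \<turnstile> Eq t u \<Longrightarrow> H \<turnstile> Eq (Succ t) (Succ u)"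
  using Eq_replace[of H t u "Eq (Succ (lift t)) (Succ (Var 0))"] by (simp add: Refl)

lemma Eq_Plus: "H \<turnstile> Eq t t' \<Longrightarrow> H \<turnstile> Eq u u' \<Longrightarrow> H \<turnstile> Eq (Plus t u) (Plus t' u')"
  using Eq_replace[of H t t' "Eq (Plus (lift t) (lift u)) (Plus (Var 0) (lift u))"]
    Eq_replace[of H u u' "Eq (Plus (lift t) (lift u)) (Plus (lift t') (Var 0))"]
  by (simp add: Refl)

lemma Eq_Times: "H \<turnstile> Eq t t' \<Longrightarrow> H \<turnstile> Eq u u' \<Longrightarrow> H \<turnstile> Eq (Times t u) (Times t' u')"
  using Eq_replace[of H t t' "Eq (Times (lift t) (lift u)) (Times (Var 0) (lift u))"]
    Eq_replace[of H u u' "Eq (Times (lift t) (lift u)) (Times (lift t') (Var 0))"]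
  by (simp add: Refl)

text \<open>\<open>AllI\<close> obtains freshness by lifting the hypotheses; this is the version
  with a named eigenvariable \<open>k\<close>, needed for variables used as Henkin
  witnesses.\<close>

lemma generalize_fresh:
  assumes "H \<turnstile> inst p (Var k)" and "\<And>q. q \<in> H \<Longrightarrow> k \<notin> fv q" and "k \<notin> fv (Forall p)"
  shows "H \<turnstile> Forall p"
proof (rule AllI)
  \<comment> \<open>Moves \<open>k\<close> to \<open>Var 0\<close> and shifts all other variables.
    It acts as \<open>flift\<close> where \<open>k\<close> is not free, and turns
    \<open>inst p (Var k)\<close> back into \<open>p\<close>.\<close>
  define s where "s n = (if n = k then Var 0 else Var (Suc n))" for n
  have "fsubst s q = flift q" if "q \<in> H" for q
    unfolding flift_def using assms(2)[OF that] by (intro fsubst_cong) (auto simp: s_def)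
  then have "fsubst s ` H = flift ` H" by simp
  moreover have "fsubst s (inst p (Var k)) = p"
  proof -
    have "fsubst s (inst p (Var k)) = fsubst (\<lambda>n. tsubst s (case_nat (Var k) Var n)) p"
      by (simp add: inst_def fsubst_fsubst)
    also have "\<dots> = fsubst Var p"
      using assms(3) by (intro fsubst_cong) (auto simp: s_def split: nat.split)
    finally show ?thesis by simp
  qed
  ultimately show "flift ` H \<turnstile> p" using proves_fsubst[OF assms(1), of s] by simp
qed


section \<open>Structures and soundness\<close>

text \<open>The operations are arbitrary, but \<open>Eq\<close> will be read as identity, so a term
  model must be a quotient by provable equality.\<close>

locale arith_structure =
  fixes zero :: 'a and succ :: "'a \<Rightarrow> 'a"
    and add :: "'a \<Rightarrow> 'a \<Rightarrow> 'a" (infixl "\<oplus>" 65)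
    and mul :: "'a \<Rightarrow> 'a \<Rightarrow> 'a" (infixl "\<otimes>" 70)
begin

primrec val :: "(nat \<Rightarrow> 'a) \<Rightarrow> tm \<Rightarrow> 'a" where
  "val e (Var n) = e n"
| "val e Zero = zero"
| "val e (Succ t) = succ (val e t)"
| "val e (Plus t u) = val e t \<oplus> val e u"
| "val e (Times t u) = val e t \<otimes> val e u"

primrec holds :: "(nat \<Rightarrow> 'a) \<Rightarrow> fm \<Rightarrow> bool" where
  "holds e (Eq t u) \<longleftrightarrow> val e t = val e u"
| "holds e Fls \<longleftrightarrow> False"
| "holds e (Imp p q) \<longleftrightarrow> (holds e p \<longrightarrow> holds e q)"
| "holds e (Forall p) \<longleftrightarrow> (\<forall>x. holds (case_nat x e) p)"

lemma val_tsubst: "val e (tsubst s t) = val (\<lambda>n. val e (s n)) t"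
  by (induction t) auto

lemma val_lift [simp]: "val (case_nat x e) (lift t) = val e t"
  by (simp add: lift_def val_tsubst)

lemma holds_fsubst: "holds e (fsubst s p) \<longleftrightarrow> holds (\<lambda>n. val e (s n)) p"
proof (induction p arbitrary: e s)
  case (Forall p)
  have "(\<lambda>n. val (case_nat x e) (up s n)) = case_nat x (\<lambda>n. val e (s n))" for x
    by (auto simp: fun_eq_iff split: nat.split)
  then show ?case by (simp add: Forall.IH)
qed (auto simp: val_tsubst)

lemma holds_inst: "holds e (inst p t) \<longleftrightarrow> holds (case_nat (val e t) e) p"
proof -
  have "(\<lambda>n. val e (case_nat t Var n)) = case_nat (val e t) e"
    by (auto simp: fun_eq_iff split: nat.split)
  then show ?thesis by (simp add: inst_def holds_fsubst)
qed

lemma holds_flift: "holds (case_nat x e) (flift p) \<longleftrightarrow> holds e p"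
  by (simp add: flift_def holds_fsubst)

text \<open>The environment varies in the induction because \<open>AllI\<close> passes to
  \<open>case_nat x e\<close>, where the lifted hypotheses say what the original ones say at
  \<open>e\<close>.\<close>

lemma soundness: "H \<turnstile> p \<Longrightarrow> (\<And>q. q \<in> H \<Longrightarrow> holds e q) \<Longrightarrow> holds e p"
proof (induction arbitrary: e rule: proves.induct)
  case (Classical p H)
  show ?case
  proof (rule ccontr)
    assume "\<not> holds e p"
    then have "holds e Fls" using Classical.prems by (intro Classical.IH) auto
    then show False by simp
  qed
next
  case (AllI H p)
  have "holds (case_nat x e) p" for x
    using AllI.prems by (intro AllI.IH) (auto simp: holds_flift)
  then show ?case by simp
qed (auto simp: holds_inst)

lemma holds_Conj: "holds e (Conj ps) \<longleftrightarrow> (\<forall>p\<in>set ps. holds e p)"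
  by (induction ps) (auto simp: Conj_def)

lemma holds_Exists_funpow: "holds e ((Exists ^^ k) p) \<Longrightarrow> \<exists>e'. holds e' p"
  by (induction k arbitrary: e) auto

lemma holds_Forall_funpow: "(\<And>e. holds e ((Forall ^^ k) p)) \<Longrightarrow> holds e p"
proof (induction k arbitrary: e)
  case (Suc k)
  have "holds e ((Forall ^^ k) p)" for e
  proof -
    \<comment> \<open>Any environment splits into head and tail, so the outermost quantifier at the
      tail yields the body at \<open>e\<close>.\<close>
    have "holds (case_nat (e 0) (\<lambda>n. e (Suc n))) ((Forall ^^ k) p)"
      using Suc.prems[of "\<lambda>n. e (Suc n)"] by simp
    moreover have "case_nat (e 0) (\<lambda>n. e (Suc n)) = e"
      by (auto simp: fun_eq_iff split: nat.split)
    ultimately show ?thesis by simp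
  qed
  then show ?case by (rule Suc.IH)
qed simp

end


section \<open>Completeness\<close>

instance tm :: countable by countable_datatype
instance fm :: countable by countable_datatype

text \<open>Free variables serve as Henkin constants, so the extension needs infinitely many
  variables that are not free in \<open>H\<close>.\<close>

lemma Henkin_extension:
  assumes "\<not> H \<turnstile> Fls" and "finite (\<Union>(fv ` H))"
  obtains M where "H \<subseteq> M" and "\<And>p. p \<in> M \<longleftrightarrow> M \<turnstile> p"
    and "\<And>p q. Imp p q \<in> M \<longleftrightarrow> (p \<in> M \<longrightarrow> q \<in> M)" and "Fls \<notin> M"
    and "\<And>p. Forall p \<in> M \<longleftrightarrow> (\<forall>t. inst p t \<in> M)"
proof -
  define good where "good G \<longleftrightarrow> \<not> G \<turnstile> Fls \<and> finite (\<Union>(fv ` G))" for G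
  \<comment> \<open>One stage of the construction: \<open>p\<close> is added unless \<open>G\<close>
    refutes it, and an accepted negated universal formula also receives a counterexample.\<close>
  define adequate where "adequate G p G' \<longleftrightarrow> G \<subseteq> G' \<and> good G' \<and> (p \<in> G' \<or> insert p G \<turnstile> Fls) \<and>
      (\<forall>q. p = Neg (Forall q) \<longrightarrow> p \<in> G' \<longrightarrow> (\<exists>t. Neg (inst q t) \<in> G'))" for G p G'
  have step: "\<exists>G'. adequate G p G'" if G: "good G" for G p
  proof (cases "insert p G \<turnstile> Fls")
    case True
    \<comment> \<open>As \<open>p\<close> is not in \<open>G\<close>, the witness clause is vacuous
      and \<open>G\<close> itself can serve as the next stage.\<close>
    then have "p \<notin> G" using G by (auto simp: good_def insert_absorb)
    then show ?thesis using G True by (auto simp: adequate_def)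
  next
    case False
    then have ok: "good (insert p G)" using G by (simp add: good_def finite_fv)
    show ?thesis
    proof (cases "\<exists>q. p = Neg (Forall q)")
      case True
      then obtain q where p: "p = Neg (Forall q)" by blast
      obtain k where k: "k \<notin> \<Union>(fv ` insert p G)"
        using ok ex_new_if_finite[OF infinite_UNIV_nat] unfolding good_def by blast
      have "good (insert (Neg (inst q (Var k))) (insert p G))"
        unfolding good_def
      proof
        show "\<not> insert (Neg (inst q (Var k))) (insert p G) \<turnstile> Fls"
        proof
          \<comment> \<open>If the witness made the set inconsistent, \<open>q\<close> would be
            derivable at the fresh \<open>k\<close>, hence \<open>Forall q\<close>, which
            contradicts \<open>p\<close>.\<close>
          assume "insert (Neg (inst q (Var k))) (insert p G) \<turnstile> Fls"
          then have "insert p G \<turnstile> inst q (Var k)" by (rule Classical)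
          then have "insert p G \<turnstile> Forall q"
            using k p by (intro generalize_fresh) auto
          then have "insert p G \<turnstile> Fls" by (metis Assm ImpE insertI1 p)
          then show False using False by blast
        qed
      qed (use ok in \<open>simp add: good_def finite_fv\<close>)
      then show ?thesis
        using p by (intro exI[of _ "insert (Neg (inst q (Var k))) (insert p G)"])
          (auto simp: adequate_def)
    next
      case False
      then show ?thesis using ok by (intro exI[of _ "insert p G"]) (auto simp: adequate_def)
    qed
  qed
  \<comment> \<open>Stage \<open>n\<close> treats the formula with number \<open>n\<close> in an
    enumeration; thus \<open>p\<close> is decided between \<open>F (to_nat p)\<close> and its
    successor.\<close>
  define F where "F = rec_nat H (\<lambda>n G. SOME G'. adequate G (from_nat n) G')"
  have F0: "F 0 = H" and FS: "F (Suc n) = (SOME G'. adequate (F n) (from_nat n) G')" for n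
    by (simp_all add: F_def)
  have good: "good (F n)" for n
  proof (induction n)
    case 0
    then show ?case using assms by (simp add: F0 good_def)
  next
    case (Suc n)
    then show ?case using someI_ex[OF step] by (auto simp: FS adequate_def)
  qed
  have adeq: "adequate (F n) (from_nat n) (F (Suc n))" for n
    unfolding FS using someI_ex[OF step[OF good]] .
  have mono: "F i \<subseteq> F j" if "i \<le> j" for i j
    by (rule lift_Suc_mono_le[OF _ that]) (use adeq in \<open>auto simp: adequate_def\<close>)
  define M where "M = (\<Union>n. F n)"
  have FM: "F n \<subseteq> M" for n by (auto simp: M_def)
  have con: "\<not> M \<turnstile> Fls"
  proof
    assume "M \<turnstile> Fls"
    then obtain A where A: "finite A" "A \<subseteq> M" "A \<turnstile> Fls" using finite_derivation by blast
    \<comment> \<open>A finite subset of the union of a chain lies in a single stage.\<close>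
    have "\<exists>n. A \<subseteq> F n" using A(1,2)
    proof (induction A)
      case (insert p A)
      then obtain i j where "A \<subseteq> F i" "p \<in> F j" by (auto simp: M_def)
      then have "insert p A \<subseteq> F (max i j)" using mono[of i "max i j"] mono[of j "max i j"] by auto
      then show ?case ..
    qed simp
    then show False using A(3) good weakening by (auto simp: good_def)
  qed
  have max: "insert p M \<turnstile> Fls" if "p \<notin> M" for p
  proof -
    have "insert p (F (to_nat p)) \<turnstile> Fls"
      using adeq[of "to_nat p"] that FM[of "Suc (to_nat p)"] by (auto simp: adequate_def)
    then show ?thesis by (rule weakening) (use FM in auto)
  qed
  have closed: "p \<in> M \<longleftrightarrow> M \<turnstile> p" for p
    using con max cut Assm by blast
  have neg: "Neg p \<in> M" if "p \<notin> M" for p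
    using max[OF that] closed ImpI by blast
  have imp: "Imp p q \<in> M \<longleftrightarrow> (p \<in> M \<longrightarrow> q \<in> M)" for p q
  proof
    assume "Imp p q \<in> M"
    then show "p \<in> M \<longrightarrow> q \<in> M" using closed ImpE by blast
  next
    assume "p \<in> M \<longrightarrow> q \<in> M"
    moreover have "M \<turnstile> Imp p q" if "p \<notin> M" using max[OF that] by (blast intro: ImpI ex_falso)
    moreover have "M \<turnstile> Imp p q" if "q \<in> M" using that by (blast intro: ImpI Assm)
    ultimately show "Imp p q \<in> M" using closed by blast
  qed
  have all: "Forall p \<in> M \<longleftrightarrow> (\<forall>t. inst p t \<in> M)" for p
  proof
    assume "Forall p \<in> M"
    then show "\<forall>t. inst p t \<in> M" using closed AllE by blast
  next
    assume *: "\<forall>t. inst p t \<in> M"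
    show "Forall p \<in> M"
    proof (rule ccontr)
      assume "Forall p \<notin> M"
      then have n: "Neg (Forall p) \<in> M" by (rule neg)
      \<comment> \<open>At this stage \<open>Neg (Forall p)\<close> was consistent, since it belongs
        to the consistent set \<open>M\<close>; so it was added together with a witness.\<close>
      let ?n = "to_nat (Neg (Forall p))"
      have "Neg (Forall p) \<in> F (Suc ?n)"
      proof (rule ccontr)
        assume "Neg (Forall p) \<notin> F (Suc ?n)"
        then have "insert (Neg (Forall p)) (F ?n) \<turnstile> Fls"
          using adeq[of ?n] by (auto simp: adequate_def)
        then have "M \<turnstile> Fls" by (rule weakening) (use n FM in auto)
        then show False using con by blast
      qed
      then obtain t where "Neg (inst p t) \<in> F (Suc ?n)"
        using adeq[of ?n] by (auto simp: adequate_def)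
      then have "Neg (inst p t) \<in> M" using FM by blast
      then show False using * imp con closed by blast
    qed
  qed
  have HM: "H \<subseteq> M" using FM[of 0] by (simp add: F0)
  have "Fls \<notin> M" using con closed by blast
  from that[OF HM closed imp this all] show ?thesis .
qed

text \<open>Distinctness of the numerals makes the term model infinite, so that it can be
  transported to the type \<open>nat\<close>.\<close>

lemma completeness:
  assumes con: "\<not> H \<turnstile> Fls" and fin: "finite (\<Union>(fv ` H))"
    and nums: "\<And>i j. j < i \<Longrightarrow> H \<turnstile> Neg (Eq (num i) (num j))"
  shows "\<exists>(zero :: nat) succ add mul e. \<forall>p\<in>H. arith_structure.holds zero succ add mul e p"
proof -
  obtain M where HM: "H \<subseteq> M" and closed: "\<And>p. p \<in> M \<longleftrightarrow> M \<turnstile> p"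
    and imp: "\<And>p q. Imp p q \<in> M \<longleftrightarrow> (p \<in> M \<longrightarrow> q \<in> M)" and fls: "Fls \<notin> M"
    and all: "\<And>p. Forall p \<in> M \<longleftrightarrow> (\<forall>t. inst p t \<in> M)"
    using Henkin_extension[OF con fin] by metis
  define cls where "cls t = {u. M \<turnstile> Eq t u}" for t
  have cls_eq: "cls t = cls u \<longleftrightarrow> M \<turnstile> Eq t u" for t u
    unfolding cls_def using Refl Eq_sym Eq_trans by blast
  have "inj (\<lambda>n. cls (num n))"
  proof (rule linorder_injI)
    fix i j :: nat assume "i < j"
    then have "Neg (Eq (num j) (num i)) \<in> M"
      using nums weakening[OF _ HM] closed by blast
    then have "\<not> M \<turnstile> Eq (num j) (num i)" using imp fls closed by blast
    then show "cls (num i) \<noteq> cls (num j)" using cls_eq by metis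
  qed
  then have "infinite (range (\<lambda>n. cls (num n)))" by (rule range_inj_infinite)
  then have inf: "infinite (range cls)" by (rule infinite_super[rotated]) auto
  have "countable (range cls)" by simp
  then obtain f :: "tm set \<Rightarrow> nat" where f: "bij_betw f (range cls) UNIV"
    using inf by (rule countableE_infinite)
  \<comment> \<open>\<open>h\<close> names the class of a term by a natural number and
    \<open>g\<close> picks a representative term, so the operations act on representatives.\<close>
  define h where "h t = f (cls t)" for t
  define g where "g = inv h"
  have "surj h" using f by (auto simp: h_def bij_betw_def image_image)
  then have hg: "h (g x) = x" for x by (simp add: g_def surj_f_inv_f)
  have h_eq: "h t = h u \<longleftrightarrow> M \<turnstile> Eq t u" for t u
    unfolding h_def inj_on_eq_iff[OF bij_betw_imp_inj_on[OF f] rangeI rangeI] by (rule cls_eq)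
  have gh: "M \<turnstile> Eq (g (h t)) t" for t using h_eq hg by blast
  interpret arith_structure "h Zero" "\<lambda>x. h (Succ (g x))" "\<lambda>x y. h (Plus (g x) (g y))"
    "\<lambda>x y. h (Times (g x) (g y))" .
  have val: "val (\<lambda>n. h (s n)) t = h (tsubst s t)" for s t
    by (induction t) (auto simp: h_eq intro: Eq_Succ Eq_Plus Eq_Times gh)
  \<comment> \<open>The truth lemma. It is stated for all \<open>s\<close> because the quantifier
    case extends \<open>s\<close> by a term; as \<open>h\<close> is surjective, the classes of terms
    exhaust the domain.\<close>
  have truth: "holds (\<lambda>n. h (s n)) p \<longleftrightarrow> fsubst s p \<in> M" for s p
  proof (induction p arbitrary: s)
    case (Eq t u)
    then show ?case by (simp add: val h_eq closed)
  next
    case (Forall p)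
    have *: "holds (case_nat (h t) (\<lambda>n. h (s n))) p \<longleftrightarrow> fsubst (case_nat t s) p \<in> M" for t
    proof -
      have "case_nat (h t) (\<lambda>n. h (s n)) = (\<lambda>n. h (case_nat t s n))"
        by (auto simp: fun_eq_iff split: nat.split)
      then show ?thesis by (simp add: Forall.IH)
    qed
    have "holds (\<lambda>n. h (s n)) (Forall p) \<longleftrightarrow> (\<forall>t. holds (case_nat (h t) (\<lambda>n. h (s n))) p)"
      by simp (metis hg)
    also have "\<dots> \<longleftrightarrow> fsubst s (Forall p) \<in> M"
      by (simp add: * all inst_fsubst_up)
    finally show ?case .
  qed (auto simp: imp fls)
  have "holds (\<lambda>n. h (Var n)) p" if "p \<in> H" for p
    using truth[of Var p] HM that by auto
  then show ?thesis by (intro exI ballI)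
qed


section \<open>Models of Peano arithmetic\<close>

lemma fv_Forall_funpow: "fv ((Forall ^^ k) p) = {n. n + k \<in> fv p}"
  by (induction k) auto

lemma PA_closed: "p \<in> PA \<Longrightarrow> fv p = {}"
  unfolding PA_def by (auto simp: less_Suc_eq)

text \<open>The axioms contain only closed closures, so \<open>k\<close> is taken above every free
  index of the instance.\<close>

lemma Induct_closure_in_PA: "\<exists>k. (Forall ^^ k) (Induct p) \<in> PA"
proof -
  obtain k where "\<forall>n\<in>fv (Induct p). n < k"
    using finite_fv[of "Induct p"] finite_nat_set_iff_bounded by blast
  then have "fv ((Forall ^^ k) (Induct p)) = {}" by (auto simp: fv_Forall_funpow)
  then show ?thesis unfolding PA_def by blast
qed

text \<open>Supplies the distinct numerals that \<open>completeness\<close> requires. Injectivity of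
  the successor reduces both numerals until one of them is zero.\<close>

lemma PA_num_distinct: "j < i \<Longrightarrow> PA \<turnstile> Neg (Eq (num i) (num j))"
proof (induction i arbitrary: j)
  case (Suc i)
  show ?case
  proof (cases j)
    case 0
    have "PA \<turnstile> Forall (Neg (Eq (Succ (Var 0)) Zero))"
      by (rule Assm) (simp add: PA_def)
    from AllE[OF this, of "num i"] show ?thesis by (simp add: 0 inst_def)
  next
    case (Suc k)
    have "PA \<turnstile> Forall (Forall (Imp (Eq (Succ (Var 1)) (Succ (Var 0))) (Eq (Var 1) (Var 0))))"
      by (rule Assm) (simp add: PA_def)
    from AllE[OF this, of "num i"]
    have "PA \<turnstile> Forall (Imp (Eq (Succ (num i)) (Succ (Var 0))) (Eq (num i) (Var 0)))"
      by (simp add: inst_def)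
    from AllE[OF this, of "num k"]
    have inj: "PA \<turnstile> Imp (Eq (Succ (num i)) (Succ (num k))) (Eq (num i) (num k))"
      by (simp add: inst_def)
    have neg: "PA \<turnstile> Neg (Eq (num i) (num k))" using Suc.IH Suc.prems Suc by simp
    let ?H = "insert (Eq (Succ (num i)) (Succ (num k))) PA"
    have "?H \<turnstile> Eq (num i) (num k)"
      by (rule ImpE[OF weakening[OF inj]]) (auto intro: Assm)
    then have "?H \<turnstile> Fls" by (rule ImpE[OF weakening[OF neg], rotated]) auto
    then show ?thesis by (simp add: Suc ImpI)
  qed
qed simp

locale PA_model = arith_structure +
  assumes PA_holds: "p \<in> PA \<Longrightarrow> holds e p"
begin

text \<open>Induction inside the model for definable properties: \<open>Var 0\<close> is the
  induction variable, and \<open>e\<close> holds the parameters as the variables from 1 on.\<close>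

lemma induction_schema:
  assumes "holds (case_nat zero e) p"
    and "\<And>x. holds (case_nat x e) p \<Longrightarrow> holds (case_nat (succ x) e) p"
  shows "holds (case_nat x e) p"
proof -
  obtain k where k: "(Forall ^^ k) (Induct p) \<in> PA" using Induct_closure_in_PA by blast
  have ax: "holds e (Induct p)" using PA_holds[OF k] by (rule holds_Forall_funpow)
  have "(\<lambda>n. val (case_nat x e) ((Var(0 := Succ (Var 0))) n)) = case_nat (succ x) e" for x
    by (auto simp: fun_eq_iff split: nat.split)
  then show ?thesis using ax assms by (simp add: Induct_def holds_inst holds_fsubst)
qed

section \<open>Elementary arithmetic in a model\<close>

lemma succ_ne_zero [simp]: "succ x \<noteq> zero"
  using PA_holds[of "Forall (Neg (Eq (Succ (Var 0)) Zero))"] by (simp add: PA_def)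

lemma succ_inject [simp]: "succ x = succ y \<longleftrightarrow> x = y"
  using PA_holds[of "Forall (Forall (Imp (Eq (Succ (Var 1)) (Succ (Var 0))) (Eq (Var 1) (Var 0))))"]
  by (auto simp: PA_def)

lemma add_zero [simp]: "x \<oplus> zero = x"
  using PA_holds[of "Forall (Eq (Plus (Var 0) Zero) (Var 0))"] by (simp add: PA_def)

lemma add_succ [simp]: "x \<oplus> succ y = succ (x \<oplus> y)"
  using PA_holds[of "Forall (Forall (Eq (Plus (Var 1) (Succ (Var 0))) (Succ (Plus (Var 1) (Var 0)))))"]
  by (simp add: PA_def)

lemma mul_zero [simp]: "x \<otimes> zero = zero"
  using PA_holds[of "Forall (Eq (Times (Var 0) Zero) Zero)"] by (simp add: PA_def)

lemma mul_succ [simp]: "x \<otimes> succ y = x \<otimes> y \<oplus> x"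
  using PA_holds[of "Forall (Forall (Eq (Times (Var 1) (Succ (Var 0)))
    (Plus (Times (Var 1) (Var 0)) (Var 1))))"]
  by (simp add: PA_def)

lemma zero_add [simp]: "zero \<oplus> x = x"
  using induction_schema[of undefined "Eq (Plus Zero (Var 0)) (Var 0)" x] by simp

lemma succ_add [simp]: "succ x \<oplus> y = succ (x \<oplus> y)"
  using induction_schema[of "\<lambda>_. x"
      "Eq (Plus (Succ (Var 1)) (Var 0)) (Succ (Plus (Var 1) (Var 0)))" y]
  by simp

lemma add_commute: "x \<oplus> y = y \<oplus> x"
  using induction_schema[of "\<lambda>_. x" "Eq (Plus (Var 1) (Var 0)) (Plus (Var 0) (Var 1))" y]
  by simp

lemma add_assoc: "x \<oplus> y \<oplus> w = x \<oplus> (y \<oplus> w)"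
  using induction_schema[of "case_nat x (\<lambda>_. y)"
      "Eq (Plus (Plus (Var 1) (Var 2)) (Var 0)) (Plus (Var 1) (Plus (Var 2) (Var 0)))" w]
  by simp

lemma add_left_commute: "x \<oplus> (y \<oplus> w) = y \<oplus> (x \<oplus> w)"
  by (metis add_assoc add_commute)

lemmas add_ac = add_assoc add_commute add_left_commute

lemma add_right_cancel [simp]: "x \<oplus> w = y \<oplus> w \<longleftrightarrow> x = y"
  using induction_schema[of "case_nat x (\<lambda>_. y)"
      "Imp (Eq (Plus (Var 1) (Var 0)) (Plus (Var 2) (Var 0))) (Eq (Var 1) (Var 2))" w]
  by auto

lemma add_left_cancel [simp]: "w \<oplus> x = w \<oplus> y \<longleftrightarrow> x = y"
  by (metis add_commute add_right_cancel)

lemma add_mul: "(x \<oplus> y) \<otimes> w = x \<otimes> w \<oplus> y \<otimes> w"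
  using induction_schema[of "case_nat x (\<lambda>_. y)"
      "Eq (Times (Plus (Var 1) (Var 2)) (Var 0))
        (Plus (Times (Var 1) (Var 0)) (Times (Var 2) (Var 0)))" w]
  by (simp add: add_ac)

lemma succ_mul: "succ x \<otimes> w = x \<otimes> w \<oplus> w"
  using induction_schema[of "\<lambda>_. x"
      "Eq (Times (Succ (Var 1)) (Var 0)) (Plus (Times (Var 1) (Var 0)) (Var 0))" w]
  by (simp add: add_ac)

section \<open>Order and division with remainder\<close>

lemma zero_or_succ: "x = zero \<or> (\<exists>y. x = succ y)"
  using induction_schema[of undefined
      "Or (Eq (Var 0) Zero) (Exists (Eq (Var 1) (Succ (Var 0))))" x]
  by auto

text \<open>Here \<open>y = succ x \<oplus> r\<close> expresses strict order. Induction on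
  \<open>x\<close>; when \<open>x\<close> lies below \<open>y\<close>, whether \<open>r\<close> is
  zero decides if \<open>succ x\<close> reaches \<open>y\<close>.\<close>

lemma trichotomy: "x = y \<or> (\<exists>r. y = succ x \<oplus> r) \<or> (\<exists>r. x = succ y \<oplus> r)"
proof -
  let ?p = "Or (Eq (Var 0) (Var 1)) (Or (Exists (Eq (Var 2) (Plus (Succ (Var 1)) (Var 0))))
    (Exists (Eq (Var 1) (Plus (Succ (Var 2)) (Var 0)))))"
  have p: "holds (case_nat x (\<lambda>_. y)) ?p \<longleftrightarrow>
      x = y \<or> (\<exists>r. y = succ x \<oplus> r) \<or> (\<exists>r. x = succ y \<oplus> r)" for x
    by auto
  have "holds (case_nat x (\<lambda>_. y)) ?p"
  proof (rule induction_schema)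
    show "holds (case_nat zero (\<lambda>_. y)) ?p"
      unfolding p using zero_or_succ[of y] by auto
  next
    fix x assume "holds (case_nat x (\<lambda>_. y)) ?p"
    then consider "x = y" | r where "y = succ x \<oplus> r" | r where "x = succ y \<oplus> r"
      unfolding p by blast
    then show "holds (case_nat (succ x) (\<lambda>_. y)) ?p"
      unfolding p
    proof cases
      case 1
      then have "succ x = succ y \<oplus> zero" by simp
      then show "succ x = y \<or> (\<exists>r. y = succ (succ x) \<oplus> r) \<or> (\<exists>r. succ x = succ y \<oplus> r)" by blast
    next
      case (2 r)
      then show "succ x = y \<or> (\<exists>r. y = succ (succ x) \<oplus> r) \<or> (\<exists>r. succ x = succ y \<oplus> r)"
        using zero_or_succ[of r] by auto
    next
      case (3 r)
      then have "succ x = succ y \<oplus> succ r" by simp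
      then show "succ x = y \<or> (\<exists>r. y = succ (succ x) \<oplus> r) \<or> (\<exists>r. succ x = succ y \<oplus> r)" by blast
    qed
  qed
  then show ?thesis unfolding p .
qed

text \<open>A larger quotient would contribute a further \<open>d\<close>; cancelling
  \<open>q \<otimes> d\<close> would make \<open>y\<close> at least \<open>d\<close>, although
  \<open>w\<close> witnesses that \<open>y\<close> is below \<open>d\<close>.\<close>

lemma quotient_not_less:
  assumes "q \<otimes> d \<oplus> y = q' \<otimes> d \<oplus> y'" and "succ y \<oplus> w = d"
  shows "q' \<noteq> succ q \<oplus> r"
proof
  assume "q' = succ q \<oplus> r"
  then have "q \<otimes> d \<oplus> y = q \<otimes> d \<oplus> (d \<oplus> (r \<otimes> d \<oplus> y'))"
    using assms(1) by (simp only: add_mul succ_mul add_assoc)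
  then have "y \<oplus> zero = succ y \<oplus> w \<oplus> (r \<otimes> d \<oplus> y')"
    unfolding assms(2) by (simp only: add_left_cancel add_zero)
  also have "\<dots> = y \<oplus> succ (w \<oplus> (r \<otimes> d \<oplus> y'))" by (simp add: add_assoc)
  finally have "zero = succ (w \<oplus> (r \<otimes> d \<oplus> y'))" by (simp only: add_left_cancel)
  then show False by (metis succ_ne_zero)
qed

text \<open>Trichotomy leaves only equal quotients, as \<open>quotient_not_less\<close> excludes
  both strict cases; the common product then cancels.\<close>

lemma remainder_unique:
  assumes "q \<otimes> d \<oplus> y = q' \<otimes> d \<oplus> y'" and "succ y \<oplus> w = d" and "succ y' \<oplus> w' = d"
  shows "y = y'"
proof -
  have "q = q'"
    using trichotomy[of q q'] quotient_not_less[OF assms(1,2)]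
      quotient_not_less[OF assms(1)[symmetric] assms(3)] by blast
  then show ?thesis using assms(1) by simp
qed

section \<open>The beta function and string lengths in a model\<close>

definition beta :: "'a \<Rightarrow> 'a \<Rightarrow> 'a \<Rightarrow> 'a \<Rightarrow> bool" where
  "beta a b i y \<longleftrightarrow>
     (\<exists>q. q \<otimes> succ (b \<otimes> succ i) \<oplus> y = a) \<and> (\<exists>w. succ y \<oplus> w = succ (b \<otimes> succ i))"

lemma beta_unique: "beta a b i y \<Longrightarrow> beta a b i y' \<Longrightarrow> y = y'"
  unfolding beta_def using remainder_unique by metis

lemma holds_Less: "holds e (Less t u) \<longleftrightarrow> (\<exists>w. succ (val e t) \<oplus> w = val e u)"
proof -
  have "lift (Succ t) = Succ (lift t)" by (simp add: lift_def)
  then show ?thesis by (simp add: Less_def Leq_def)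
qed

lemma holds_Leq: "holds e (Leq t u) \<longleftrightarrow> (\<exists>w. val e t \<oplus> w = val e u)"
  by (simp add: Leq_def)

lemma holds_Beta:
  "holds e (Beta a b i y) \<longleftrightarrow> beta (val e a) (val e b) (val e i) (val e y)"
proof -
  have "lift (Succ (Times b (Succ i))) = Succ (Times (lift b) (Succ (lift i)))"
    by (simp add: lift_def)
  then show ?thesis by (simp add: Beta_def Let_def holds_Less beta_def)
qed

definition has_length :: "'a \<Rightarrow> 'a \<Rightarrow> bool" where
  "has_length x l \<longleftrightarrow> (\<exists>a b. beta a b zero zero \<and> beta a b l x \<and>
     (\<forall>i. (\<exists>w. succ i \<oplus> w = l) \<longrightarrow> (\<exists>u v. beta a b i u \<and> beta a b (succ i) v \<and>
       (v = succ (u \<oplus> u) \<or> v = succ (succ (u \<oplus> u))))))"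

lemma holds_Len: "holds e (Len x l) \<longleftrightarrow> has_length (val e x) (val e l)"
  by (simp add: Len_def has_length_def holds_Beta holds_Less disj_imp)

abbreviation std :: "nat \<Rightarrow> 'a" where
  "std n \<equiv> (succ ^^ n) zero"

lemma val_num [simp]: "val e (num n) = std n"
  by (induction n) auto

lemma std_add: "std (i + j) = std i \<oplus> std j"
  by (induction i) auto

text \<open>Ordinary induction on the position \<open>i\<close> up to the standard number
  \<open>n\<close>: by \<open>beta_unique\<close> the coded sequence has one value at each position,
  and each step adds one bit to an actual string.\<close>

lemma has_standard_length:
  assumes "has_length x (std n)"
  obtains w where "length w = n" and "x = std (code w)"
proof -
  obtain a b where 0: "beta a b zero zero" and n: "beta a b (std n) x"
    and step: "\<And>i w. succ i \<oplus> w = std n \<Longrightarrow> \<exists>u v. beta a b i u \<and> beta a b (succ i) v \<and>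
       (v = succ (u \<oplus> u) \<or> v = succ (succ (u \<oplus> u)))"
    using assms unfolding has_length_def by blast
  have "\<exists>w. length w = i \<and> y = std (code w)" if "i \<le> n" "beta a b (std i) y" for i y
    using that
  proof (induction i arbitrary: y)
    case 0
    then have "y = zero" using beta_unique \<open>beta a b zero zero\<close> by simp
    then show ?case by simp
  next
    case (Suc i)
    \<comment> \<open>The element \<open>std (n - Suc i)\<close> witnesses inside the model that
      position \<open>i\<close> lies below the length, so the recurrence applies there.\<close>
    have "succ (std i) \<oplus> std (n - Suc i) = std n"
      using Suc.prems(1) std_add[of "Suc i" "n - Suc i"] by simp
    then obtain u v where u: "beta a b (std i) u" and v: "beta a b (succ (std i)) v"
      and uv: "v = succ (u \<oplus> u) \<or> v = succ (succ (u \<oplus> u))"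
      using step by blast
    obtain w where w: "length w = i" "u = std (code w)" using Suc.IH[OF _ u] Suc.prems(1) by auto
    have y: "y = v" using beta_unique[OF Suc.prems(2)] v by simp
    from uv have "\<exists>c. v = std (code (c # w))"
    proof
      assume "v = succ (u \<oplus> u)"
      then have "v = std (code (False # w))" by (simp add: w mult_2 std_add)
      then show ?thesis ..
    next
      assume "v = succ (succ (u \<oplus> u))"
      then have "v = std (code (True # w))" by (simp add: w mult_2 std_add)
      then show ?thesis ..
    qed
    then show ?case using y w by (metis length_Cons)
  qed
  then show ?thesis using n that by blast
qed

section \<open>From witnesses in the model to actual strings\<close>

lemma holds_app2: "holds e (app2 d t u) \<longleftrightarrow> holds (case_nat (val e t) (\<lambda>_. val e u)) d"
proof -
  have "(\<lambda>i. val e (if i = 0 then t else u)) = case_nat (val e t) (\<lambda>_. val e u)"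
    by (auto simp: fun_eq_iff split: nat.split)
  then show ?thesis by (simp add: app2_def holds_fsubst)
qed

text \<open>\<open>app2\<close> replaces every variable of \<open>d\<close>, and the bound is a
  numeral, so the environment enters only through the value of \<open>x\<close>. This transfers
  randomness from a witness to the numeral of its string.\<close>

lemma holds_CRandom_cong:
  assumes "val e x = val e' x'"
  shows "holds e (CRandom d c n x) \<longleftrightarrow> holds e' (CRandom d c n x')"
  by (simp add: CRandom_def CGeq_def CEq_def HasProg_def holds_app2 holds_Len holds_Leq assms)

lemma standard_witnesses:
  assumes "holds e (AtLeast k (\<lambda>x. And (Len x (num n)) (CRandom d c n x)))"
  shows "\<exists>S \<subseteq> {w. length w = n}. card S = k \<and> (\<forall>w\<in>S. holds e (CRandom d c n (num (code w))))"
proof -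
  obtain e' where
    ne: "\<And>i j. i < j \<Longrightarrow> j < k \<Longrightarrow> e' i \<noteq> e' j" and
    len: "\<And>i. i < k \<Longrightarrow> has_length (e' i) (std n)" and
    rnd: "\<And>i. i < k \<Longrightarrow> holds e' (CRandom d c n (Var i))"
    using holds_Exists_funpow[OF assms[unfolded AtLeast_def]]
    by (fastforce simp: holds_Conj holds_Len)
  have "\<exists>w. length w = n \<and> e' i = std (code w)" if "i < k" for i
    using has_standard_length[OF len[OF that]] by metis
  then obtain w where w: "\<And>i. i < k \<Longrightarrow> length (w i) = n \<and> e' i = std (code (w i))"
    by metis
  have "inj_on w {..<k}"
  proof (rule inj_onI)
    fix i j assume "i \<in> {..<k}" "j \<in> {..<k}" "w i = w j"
    \<comment> \<open>Equal strings would have the same numeral value, hence come from equal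
      witnesses, against the pairwise distinctness in \<open>AtLeast\<close>.\<close>
    moreover from this have "e' i = e' j" using w by simp
    ultimately show "i = j" using ne[of i j] ne[of j i] by (cases i j rule: linorder_cases) auto
  qed
  then have "card (w ` {..<k}) = k" by (simp add: card_image)
  moreover have "holds e (CRandom d c n (num (code (w i))))" if "i < k" for i
    using rnd[OF that] w[OF that] holds_CRandom_cong[of e' "Var i" e "num (code (w i))"] by simp
  ultimately show ?thesis using w by (intro exI[of _ "w ` {..<k}"]) auto
qed

end

text \<open>Completeness applied to the axioms with \<open>Neg \<phi>\<close>. As
  \<open>\<phi>\<close> may have free variables, the failure is relative to an environment
  \<open>e\<close>; there are finitely many such variables, as the Henkin construction
  requires.\<close>

lemma PA_countermodel:
  assumes "\<not> PA \<turnstile> \<phi>"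
  shows "\<exists>(zero :: nat) succ add mul e. PA_model zero succ add mul \<and>
    \<not> arith_structure.holds zero succ add mul e \<phi>"
proof -
  let ?H = "insert (Neg \<phi>) PA"
  have con: "\<not> ?H \<turnstile> Fls" using assms Classical by blast
  have "\<Union>(fv ` ?H) = fv \<phi>" using PA_closed by auto
  then have fin: "finite (\<Union>(fv ` ?H))" by (simp only: finite_fv)
  have "?H \<turnstile> Neg (Eq (num i) (num j))" if "j < i" for i j
    by (rule weakening[OF PA_num_distinct[OF that]]) auto
  from completeness[OF con fin this] obtain zero :: nat and succ add mul e
    where H: "\<And>p. p \<in> ?H \<Longrightarrow> arith_structure.holds zero succ add mul e p" by blast
  interpret arith_structure zero succ add mul .
  have "holds e' p" if p: "p \<in> PA" for e' p
  proof -
    \<comment> \<open>Axioms are sentences: closing them by \<open>Zero\<close> changes nothing, and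
      this makes their truth independent of the environment.\<close>
    have "fsubst (\<lambda>_. Zero) p = p"
      using PA_closed[OF p] fsubst_cong[of p "\<lambda>_. Zero" Var] by simp
    then show ?thesis using H[of p] p holds_fsubst[of e "\<lambda>_. Zero" p]
        holds_fsubst[of e' "\<lambda>_. Zero" p] by simp
  qed
  then have "PA_model zero succ add mul" by unfold_locales
  moreover have "\<not> holds e \<phi>" using H[of "Neg \<phi>"] by simp
  ultimately show ?thesis by (intro exI conjI)
qed

theorem theorem9:
  fixes c :: int and m :: "nat \<Rightarrow> nat" and \<phi> d :: fm
    and D :: "bool list \<Rightarrow> bool list option"
  assumes "provably_optimal d D"
    and "computable m"
    and "\<And>n. PA \<turnstile> AtLeast (m n) (\<lambda>x. And (Len x (num n)) (CRandom d c n x))"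
    and "\<not> PA \<turnstile> \<phi>"
  shows "\<exists>S :: nat \<Rightarrow> bool list set.
           (\<forall>n. S n \<subseteq> {x. length x = n} \<and> card (S n) = m n) \<and>
           \<not> PA \<union> {CRandom d c n (num (code x)) | n x. x \<in> S n} \<turnstile> \<phi>"
proof -
  obtain zero :: nat and succ add mul e where "PA_model zero succ add mul"
    and \<phi>: "\<not> arith_structure.holds zero succ add mul e \<phi>"
    using PA_countermodel[OF assms(4)] by blast
  then interpret PA_model zero succ add mul by simp
  \<comment> \<open>The model and \<open>e\<close> are fixed before \<open>n\<close>, so the sets
    chosen separately for each \<open>n\<close> give axioms that all hold together.\<close>
  have "\<exists>S \<subseteq> {w. length w = n}. card S = m n \<and>
      (\<forall>w\<in>S. holds e (CRandom d c n (num (code w))))" for n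
    by (intro standard_witnesses soundness[OF assms(3)] PA_holds)
  then obtain S where S: "\<And>n. S n \<subseteq> {w. length w = n} \<and> card (S n) = m n \<and>
      (\<forall>w\<in>S n. holds e (CRandom d c n (num (code w))))"
    by metis
  then have "\<forall>n. S n \<subseteq> {x. length x = n} \<and> card (S n) = m n" by blast
  moreover have "\<not> PA \<union> {CRandom d c n (num (code x)) | n x. x \<in> S n} \<turnstile> \<phi>"
  proof
    assume "PA \<union> {CRandom d c n (num (code x)) | n x. x \<in> S n} \<turnstile> \<phi>"
    then have "holds e \<phi>" by (rule soundness) (use S PA_holds in auto)
    then show False using \<phi> by simp
  qed
  ultimately show ?thesis by (intro exI[of _ S] conjI)
qed

end
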